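(* Let $f:\mathbb{R}^n\to\mathbb{R}$ be a non-convex differentiable function satisfying the $q$-coordinate Lipschitz gradient assumption with constants $L_J>0$, and let $\{x^m\}_{m\ge 0}$ be the sequence generated by the $q$-RCCD algorithm, using the uniform distribution, for the problem $\min\{f(x): a^\top x=b,\ e_i\le x_i\le g_i,\ i\in[n]\}$. Then any accumulation point of the sequence $\{x^m\}$ is a stationary point of this problem.
   Context: Setting. Let $n,q\in\mathbb{N}$ with $2\le q<n$, $[n]=\{1,\dots,n\}$, $a,e,g\in\mathbb{R}^n$ with $e\le g$ componentwise, $b\in\mathbb{R}$, and $P=\{x\in\mathbb{R}^n: a^\top x=b,\ e_i\le x_i\le g_i,\ i\in[n]\}$. Let $\mathcal{J}_q=\{J\subseteq[n]:|J|=q\}$. $\|\cdot\|$ is the Euclidean norm. $q$-coordinate Lipschitz gradient assumption. For every $J\in\mathcal{J}_q$ there is a constant $L_J>0$ (fixed throughout) such that $\|\nabla_J f(x+s_J)-\nabla_J f(x)\|\le L_J\|s_J\|$ for all $x\in\mathbb{R}^n$ and all $s_J\in\mathbb{R}^n$ whose entries outside $J$ are zero; here $\nabla_J f(x)\in\mathbb{R}^n$ has entries $\partial f(x)/\partial x_j$ for $j\in J$ and $0$ for $j\notin J$. $q$-RCCD algorithm (run without stopping). Start from some $x^0\in P$. At iteration $m=0,1,2,\dots$, draw $J_m\in\mathcal{J}_q$ uniformly at random, independently of the previous draws; let $u^m=(u^m_j)_{j\in J_m}$ be the unique minimizer of $\sum_{j\in J_m}\frac{\partial f(x^m)}{\partial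 x_j}(\bar u_j-x^m_j)+\frac{L_{J_m}}{2}\sum_{j\in J_m}(\bar u_j-x^m_j)^2$ subject to $\sum_{j\in J_m}a_j\bar u_j=\sum_{j\in J_m}a_jx^m_j$ and $e_j\le\bar u_j\le g_j$ for $j\in J_m$; let $d_{J_m}(x^m)\in\mathbb{R}^n$ have entries $u^m_j-x^m_j$ for $j\in J_m$ and $0$ otherwise; set $x^{m+1}=x^m+d_{J_m}(x^m)$. Stationary point. A point $x^*\in P$ is a stationary point of the problem if there exist $\lambda^*\in\mathbb{R}$ and $\gamma^*,\delta^*\in\mathbb{R}^n_+$ (entrywise nonnegative) with $\nabla f(x^* )+\lambda^*a-\gamma^*+\delta^*=0$, $\gamma^*_j(x^*_j-e_j)=0$ and $\delta^*_j(g_j-x^*_j)=0$ for all $j\in[n]$. *)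

theory Defs
  imports "HOL-Probability.Probability"
begin

definition feasible_set ::
    "real ^ 'n \<Rightarrow> real \<Rightarrow> real ^ 'n \<Rightarrow> real ^ 'n \<Rightarrow> (real ^ 'n) set" where
  "feasible_set a b e g = {x. a \<bullet> x = b \<and> (\<forall>i. e $ i \<le> x $ i \<and> x $ i \<le> g $ i)}"

definition coord_sets :: "nat \<Rightarrow> 'n::finite set set" where
  "coord_sets q = {J. card J = q}"

definition partial_deriv :: "(real ^ 'n \<Rightarrow> real) \<Rightarrow> real ^ 'n \<Rightarrow> 'n::finite \<Rightarrow> real" where
  "partial_deriv f x j = deriv (\<lambda>t. f (x + t *\<^sub>R axis j 1)) 0"

definition gradient :: "(real ^ 'n::finite \<Rightarrow> real) \<Rightarrow> real ^ 'n \<Rightarrow> real ^ 'n" where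
  "gradient f x = (\<chi> j. partial_deriv f x j)"

definition coord_gradient ::
    "(real ^ 'n::finite \<Rightarrow> real) \<Rightarrow> 'n set \<Rightarrow> real ^ 'n \<Rightarrow> real ^ 'n" where
  "coord_gradient f J x = (\<chi> j. if j \<in> J then partial_deriv f x j else 0)"

definition coord_Lipschitz_gradient ::
    "nat \<Rightarrow> ('n set \<Rightarrow> real) \<Rightarrow> (real ^ 'n::finite \<Rightarrow> real) \<Rightarrow> bool" where
  "coord_Lipschitz_gradient q L f \<longleftrightarrow>
     (\<forall>J\<in>coord_sets q. L J > 0 \<and>
       (\<forall>x s. (\<forall>j. j \<notin> J \<longrightarrow> s $ j = 0) \<longrightarrow>
          norm (coord_gradient f J (x + s) - coord_gradient f J x) \<le> L J * norm s))"

text \<open>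
  The unknown \<open>u = (u\<^sub>j)\<^sub>j\<^sub>\<in>\<^sub>J\<close> of the subproblem is an extensional function on \<open>J\<close>:
  without that restriction its values outside \<open>J\<close> would be free and the minimizer not unique.
\<close>

definition subproblem_feasible ::
    "real ^ 'n \<Rightarrow> real ^ 'n \<Rightarrow> real ^ 'n \<Rightarrow> 'n::finite set \<Rightarrow> real ^ 'n \<Rightarrow> ('n \<Rightarrow> real) set" where
  "subproblem_feasible a e g J x =
     {u \<in> extensional J. (\<Sum>j\<in>J. a $ j * u j) = (\<Sum>j\<in>J. a $ j * x $ j) \<and>
        (\<forall>j\<in>J. e $ j \<le> u j \<and> u j \<le> g $ j)}"

definition subproblem_objective ::
    "(real ^ 'n \<Rightarrow> real) \<Rightarrow> ('n set \<Rightarrow> real) \<Rightarrow> 'n::finite set \<Rightarrow> real ^ 'n \<Rightarrow> ('n \<Rightarrow> real) \<Rightarrow> real"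
  where
  "subproblem_objective f L J x u =
     (\<Sum>j\<in>J. partial_deriv f x j * (u j - x $ j)) + L J / 2 * (\<Sum>j\<in>J. (u j - x $ j)\<^sup>2)"

text \<open>
  For \<open>x\<close> in the feasible set and \<open>L J > 0\<close> the subproblem is a strictly convex program over a
  nonempty compact set (it contains the restriction of \<open>x\<close> to \<open>J\<close>), so the definite description
  below denotes its unique minimizer; every iterate stays in the feasible set.
\<close>

definition subproblem_solution ::
    "(real ^ 'n \<Rightarrow> real) \<Rightarrow> ('n set \<Rightarrow> real) \<Rightarrow> real ^ 'n \<Rightarrow> real ^ 'n \<Rightarrow> real ^ 'n \<Rightarrow>
     'n::finite set \<Rightarrow> real ^ 'n \<Rightarrow> 'n \<Rightarrow> real" where
  "subproblem_solution f L a e g J x =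
     (THE u. is_arg_min (subproblem_objective f L J x) (\<lambda>u. u \<in> subproblem_feasible a e g J x) u)"

definition direction ::
    "(real ^ 'n \<Rightarrow> real) \<Rightarrow> ('n set \<Rightarrow> real) \<Rightarrow> real ^ 'n \<Rightarrow> real ^ 'n \<Rightarrow> real ^ 'n \<Rightarrow>
     'n::finite set \<Rightarrow> real ^ 'n \<Rightarrow> real ^ 'n" where
  "direction f L a e g J x =
     (\<chi> j. if j \<in> J then subproblem_solution f L a e g J x j - x $ j else 0)"

primrec rccd ::
    "(real ^ 'n \<Rightarrow> real) \<Rightarrow> ('n set \<Rightarrow> real) \<Rightarrow> real ^ 'n \<Rightarrow> real ^ 'n \<Rightarrow> real ^ 'n \<Rightarrow>
     real ^ 'n \<Rightarrow> (nat \<Rightarrow> 'n::finite set) \<Rightarrow> nat \<Rightarrow> real ^ 'n" where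
  "rccd f L a e g x0 J 0 = x0"
| "rccd f L a e g x0 J (Suc m) =
     rccd f L a e g x0 J m + direction f L a e g (J m) (rccd f L a e g x0 J m)"

text \<open>
  An accumulation point of a sequence is a limit of a subsequence; this differs from a limit point
  of the range, since a value attained infinitely often counts.
\<close>

definition accumulation_point :: "(nat \<Rightarrow> 'a::topological_space) \<Rightarrow> 'a \<Rightarrow> bool" where
  "accumulation_point X z \<longleftrightarrow> (\<exists>r::nat \<Rightarrow> nat. strict_mono r \<and> (X \<circ> r) \<longlonglongrightarrow> z)"

definition stationary_point ::
    "(real ^ 'n::finite \<Rightarrow> real) \<Rightarrow> real ^ 'n \<Rightarrow> real \<Rightarrow> real ^ 'n \<Rightarrow> real ^ 'n \<Rightarrow> real ^ 'n \<Rightarrow> bool"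
  where
  "stationary_point f a b e g z \<longleftrightarrow>
     z \<in> feasible_set a b e g \<and>
     (\<exists>(lam::real) (gam::real ^ 'n) (del::real ^ 'n).
        (\<forall>j. gam $ j \<ge> 0 \<and> del $ j \<ge> 0) \<and>
        gradient f z + lam *\<^sub>R a - gam + del = 0 \<and>
        (\<forall>j. gam $ j * (z $ j - e $ j) = 0 \<and> del $ j * (g $ j - z $ j) = 0))"

text \<open>
  The draws \<open>J\<close> are random variables on an arbitrary probability space \<open>M\<close>: jointly independent,
  each uniformly distributed on the coordinate sets of size \<open>q\<close>.
\<close>

definition uniform_draws :: "'w measure \<Rightarrow> nat \<Rightarrow> (nat \<Rightarrow> 'w \<Rightarrow> 'n::finite set) \<Rightarrow> bool" where
  "uniform_draws M q J \<longleftrightarrow>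
     prob_space.indep_vars M (\<lambda>_. count_space UNIV) J UNIV \<and>
     (\<forall>m. distr M (count_space UNIV) (J m) = measure_pmf (pmf_of_set (coord_sets q)))"

end

theory Submission
  imports Defs
begin

text \<open>
  The proof separates a pathwise part, valid for every sequence of blocks, from a probabilistic part.

  Pathwise, the subproblem for a block \<open>J\<close> is a Euclidean projection of a gradient step: completing
  the square turns its objective into \<open>L J / 2\<close> times a squared distance, up to a constant. Hence
  the step satisfies the variational inequality of a projection onto a convex set. Tested at the
  current iterate, that inequality and the block Lipschitz bound show that \<open>f\<close> drops by at least
  \<open>L J / 2\<close> times the squared step length (\<open>step_descent\<close>). The feasible set is compact and \<open>f\<close>
  continuous, so the sum of these drops is bounded, by a constant that does not depend on the draws
  (\<open>sum_steps_bounded\<close>).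

  This controls only the steps along the blocks that were drawn, whereas stationarity of a limit
  concerns all blocks: along a convergent subsequence the draws could systematically avoid a
  block. Randomness excludes this. The iterate \<open>x\<^sup>m\<close> depends on the draws before time \<open>m\<close> only, so
  drawing \<open>J\<close> at time \<open>m\<close> is independent of \<open>x\<^sup>m\<close> and has a fixed probability \<open>p > 0\<close>. The expected
  sum of \<open>\<parallel>d\<^sub>J(x\<^sup>m)\<parallel>\<^sup>2\<close> over all \<open>m\<close> is therefore \<open>1 / p\<close> times the expected sum over those \<open>m\<close> at which
  \<open>J\<close> is drawn, which is finite (\<open>AE_suminf_history_finite\<close>). So almost surely \<open>d\<^sub>J(x\<^sup>m) \<longlonglongrightarrow> 0\<close> for
  every block \<open>J\<close> simultaneously, and on that event all accumulation points are treated at once.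

  Let \<open>z\<close> be such a point. Since two coordinates always lie in a common block (\<open>q \<ge> 2\<close>), the block
  conditions make the whole gradient Lipschitz, hence continuous, and passing to the limit in the
  variational inequalities gives \<open>\<nabla>f(z) \<bullet> w \<ge> 0\<close> for every feasible displacement \<open>w\<close> supported in a
  block (\<open>limit_variational_inequality\<close>). Displacements supported on two coordinates suffice for
  the multiplier conditions: a coordinate \<open>j\<close> with \<open>a\<^sub>j \<noteq> 0\<close> constrains the multiplier of the equality
  constraint only through lower or upper bounds equal to \<open>- \<nabla>f(z)\<^sub>j / a\<^sub>j\<close>, and finitely many lower
  and upper bounds admit a common value as soon as they are compatible in pairs
  (\<open>stationary_point_if_pairwise\<close>).
\<close>

section \<open>Differentiability and the descent inequality\<close>

lemma has_derivative_gradient: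
  fixes f :: "real ^ 'n::finite \<Rightarrow> real"
  assumes "f differentiable (at x)"
  shows "(f has_derivative (\<lambda>s. gradient f x \<bullet> s)) (at x)"
proof -
  obtain D where D: "(f has_derivative D) (at x)"
    using assms unfolding differentiable_def by auto
  interpret D: bounded_linear D
    using D by (rule has_derivative_bounded_linear)
  have partial: "partial_deriv f x j = D (axis j 1)" for j
  proof -
    have "((\<lambda>t. x + t *\<^sub>R axis j 1) has_derivative (\<lambda>t. t *\<^sub>R axis j 1)) (at 0)"
      by (auto intro!: derivative_eq_intros)
    moreover have "(f has_derivative D) (at (x + 0 *\<^sub>R axis j 1))"
      using D by simp
    ultimately have "((\<lambda>t. f (x + t *\<^sub>R axis j 1)) has_derivative (\<lambda>t. D (t *\<^sub>R axis j 1))) (at 0)"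
      by (rule has_derivative_compose)
    then have "((\<lambda>t. f (x + t *\<^sub>R axis j 1)) has_field_derivative D (axis j 1)) (at 0)"
      unfolding has_field_derivative_def
      by (rule has_derivative_eq_rhs) (simp add: D.scaleR fun_eq_iff mult.commute)
    then show ?thesis
      unfolding partial_deriv_def by (rule DERIV_imp_deriv)
  qed
  have "D s = gradient f x \<bullet> s" for s
  proof -
    have "D s = D (\<Sum>j\<in>UNIV. s $ j *\<^sub>R axis j 1)"
      using basis_expansion[of s] by (simp add: scalar_mult_eq_scaleR)
    also have "\<dots> = (\<Sum>j\<in>UNIV. partial_deriv f x j * s $ j)"
      by (simp add: D.sum D.scaleR partial mult.commute)
    finally show ?thesis
      by (simp add: gradient_def inner_vec_def)
  qed
  then have "D = (\<lambda>s. gradient f x \<bullet> s)" by auto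
  with D show ?thesis by simp
qed

lemma gradient_inner_supported:
  fixes f :: "real ^ 'n::finite \<Rightarrow> real"
  assumes "\<And>j. j \<notin> J \<Longrightarrow> s $ j = 0"
  shows "gradient f x \<bullet> s = coord_gradient f J x \<bullet> s"
  unfolding inner_vec_def
  by (rule sum.cong) (auto simp: gradient_def coord_gradient_def assms)

lemma
  fixes f :: "real ^ 'n::finite \<Rightarrow> real"
  assumes "coord_Lipschitz_gradient q L f" and "J \<in> coord_sets q"
  shows coord_Lipschitz_pos: "L J > 0"
    and coord_LipschitzD: "(\<And>j. j \<notin> J \<Longrightarrow> s $ j = 0) \<Longrightarrow>
      norm (coord_gradient f J (x + s) - coord_gradient f J x) \<le> L J * norm s"
  using assms by (simp_all add: coord_Lipschitz_gradient_def)

text \<open>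
  Subtracting the claimed upper bound from \<open>f\<close> along the segment leaves a function \<open>\<phi>\<close> whose
  derivative is nonpositive by Cauchy-Schwarz and the Lipschitz bound. The segment stays in
  directions supported on \<open>J\<close>, so the Lipschitz bound for that single block is enough.
\<close>
lemma descent_inequality:
  fixes f :: "real ^ 'n::finite \<Rightarrow> real"
  assumes diff: "\<And>x. f differentiable (at x)"
    and Lip: "coord_Lipschitz_gradient q L f" and J: "J \<in> coord_sets q"
    and s: "\<And>j. j \<notin> J \<Longrightarrow> s $ j = 0"
  shows "f (x + s) \<le> f x + coord_gradient f J x \<bullet> s + L J / 2 * (norm s)\<^sup>2"
proof -
  define \<phi> where "\<phi> t = f (x + t *\<^sub>R s) - t * (gradient f x \<bullet> s) - L J / 2 * t\<^sup>2 * (norm s)\<^sup>2"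
    for t :: real
  have deriv: "(\<phi> has_real_derivative
      (gradient f (x + t *\<^sub>R s) \<bullet> s - gradient f x \<bullet> s - L J * t * (norm s)\<^sup>2)) (at t)" for t
  proof -
    have "((\<lambda>t. x + t *\<^sub>R s) has_derivative (\<lambda>h. h *\<^sub>R s)) (at t)"
      by (auto intro!: derivative_eq_intros)
    then have "((\<lambda>t. f (x + t *\<^sub>R s)) has_derivative
        (\<lambda>h. gradient f (x + t *\<^sub>R s) \<bullet> (h *\<^sub>R s))) (at t)"
      using has_derivative_gradient[OF diff] by (rule has_derivative_compose)
    then have [derivative_intros]: "((\<lambda>t. f (x + t *\<^sub>R s)) has_real_derivative
        gradient f (x + t *\<^sub>R s) \<bullet> s) (at t)"
      unfolding has_field_derivative_def
      by (rule has_derivative_eq_rhs) (simp add: fun_eq_iff mult.commute)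
    show ?thesis
      unfolding \<phi>_def by (auto intro!: derivative_eq_intros)
  qed
  have nonpos: "gradient f (x + t *\<^sub>R s) \<bullet> s - gradient f x \<bullet> s - L J * t * (norm s)\<^sup>2 \<le> 0"
    if "0 \<le> t" for t
  proof -
    have "gradient f (x + t *\<^sub>R s) \<bullet> s - gradient f x \<bullet> s
        = (coord_gradient f J (x + t *\<^sub>R s) - coord_gradient f J x) \<bullet> s"
      by (simp add: gradient_inner_supported[OF s] inner_diff_left)
    also have "\<dots> \<le> norm (coord_gradient f J (x + t *\<^sub>R s) - coord_gradient f J x) * norm s"
      by (rule norm_cauchy_schwarz)
    also have "\<dots> \<le> (L J * norm (t *\<^sub>R s)) * norm s"
      using s by (intro mult_right_mono coord_LipschitzD[OF Lip J]) auto
    also have "\<dots> = L J * t * (norm s)\<^sup>2"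
      using that by (simp add: power2_eq_square)
    finally show ?thesis by simp
  qed
  have "\<phi> 1 \<le> \<phi> 0"
  proof (rule DERIV_nonpos_imp_nonincreasing[where f = \<phi>])
    fix t :: real
    assume "0 \<le> t"
    then show "\<exists>y. (\<phi> has_real_derivative y) (at t) \<and> y \<le> 0"
      using deriv nonpos by blast
  qed simp
  then show ?thesis
    by (simp add: \<phi>_def gradient_inner_supported[OF s])
qed

text \<open>
  The hypothesis controls \<open>\<nabla>\<^sub>J f\<close> only under displacements inside \<open>J\<close>. To bound the change of the
  partial derivative \<open>j\<close> between arbitrary points, the coordinates are exchanged one at a time:
  exchanging coordinate \<open>i\<close> is governed by any block containing both \<open>i\<close> and \<open>j\<close>, and such a
  block exists because \<open>q \<ge> 2\<close>.
\<close>
lemma continuous_gradient: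
  fixes f :: "real ^ 'n::finite \<Rightarrow> real"
  assumes Lip: "coord_Lipschitz_gradient q L f" and q: "2 \<le> q" "q \<le> CARD('n)"
  shows "continuous_on UNIV (gradient f)"
proof -
  define K where "K = (\<Sum>J\<in>coord_sets q. L J)"
  note pos = coord_Lipschitz_pos[OF Lip]
  have L_le: "L J \<le> K" if "J \<in> coord_sets q" for J
    unfolding K_def using that pos by (intro member_le_sum) (auto intro: less_imp_le)
  have single: "\<bar>partial_deriv f (x + t *\<^sub>R axis i 1) j - partial_deriv f x j\<bar> \<le> K * \<bar>t\<bar>" for x i j t
  proof -
    have "card {i, j} \<le> q"
      using q card_insert_le_m1[of 2 "{j}" i] by (simp add: card_insert_if)
    then obtain J where J: "{i, j} \<subseteq> J" "card J = q"
      using exists_subset_between[of "{i, j}" q UNIV] q by auto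
    then have Jq: "J \<in> coord_sets q" by (simp add: coord_sets_def)
    let ?s = "t *\<^sub>R axis i 1 :: real ^ 'n"
    have "\<bar>partial_deriv f (x + ?s) j - partial_deriv f x j\<bar>
        = \<bar>(coord_gradient f J (x + ?s) - coord_gradient f J x) $ j\<bar>"
      using J by (simp add: coord_gradient_def)
    also have "\<dots> \<le> norm (coord_gradient f J (x + ?s) - coord_gradient f J x)"
      by (rule component_le_norm_cart)
    also have "\<dots> \<le> L J * norm ?s"
      using J by (intro coord_LipschitzD[OF Lip Jq]) (auto simp: axis_def)
    also have "\<dots> \<le> K * \<bar>t\<bar>"
      using L_le[OF Jq] by (auto intro: mult_right_mono)
    finally show ?thesis .
  qed
  have Lip1: "\<bar>partial_deriv f x j - partial_deriv f y j\<bar> \<le> K * (\<Sum>i\<in>UNIV. \<bar>x $ i - y $ i\<bar>)" for x y j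
  proof -
    define mix :: "'n set \<Rightarrow> real ^ 'n" where "mix A = (\<chi> i. if i \<in> A then x $ i else y $ i)" for A
    have "\<bar>partial_deriv f (mix A) j - partial_deriv f y j\<bar> \<le> K * (\<Sum>i\<in>A. \<bar>x $ i - y $ i\<bar>)" for A
      using finite[of A]
    proof induction
      case empty
      have "mix {} = y" by (simp add: mix_def vec_eq_iff)
      then show ?case by simp
    next
      case (insert i A)
      have "mix (insert i A) = mix A + (x $ i - y $ i) *\<^sub>R axis i 1"
        using insert.hyps by (auto simp: mix_def vec_eq_iff axis_def)
      then have "\<bar>partial_deriv f (mix (insert i A)) j - partial_deriv f (mix A) j\<bar>
          \<le> K * \<bar>x $ i - y $ i\<bar>"
        using single by simp
      then show ?case
        using insert by (simp add: distrib_left)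
    qed
    moreover have "mix UNIV = x" by (simp add: mix_def vec_eq_iff)
    ultimately show ?thesis by metis
  qed
  have "(gradient f \<longlongrightarrow> gradient f y) (at y)" for y
  proof (rule vec_tendstoI)
    fix j
    have "((\<lambda>x. K * (\<Sum>i\<in>UNIV. \<bar>x $ i - y $ i\<bar>)) \<longlongrightarrow> K * (\<Sum>i\<in>UNIV. \<bar>y $ i - y $ i\<bar>)) (at y)"
      by (intro tendsto_intros)
    then have "((\<lambda>x. K * (\<Sum>i\<in>UNIV. \<bar>x $ i - y $ i\<bar>)) \<longlongrightarrow> 0) (at y)"
      by simp
    then have "((\<lambda>x. partial_deriv f x j - partial_deriv f y j) \<longlongrightarrow> 0) (at y)"
      by (rule Lim_null_comparison[rotated]) (simp add: Lip1)
    then show "((\<lambda>x. gradient f x $ j) \<longlongrightarrow> gradient f y $ j) (at y)"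
      by (simp add: gradient_def LIM_zero_iff)
  qed
  then show ?thesis
    by (simp add: continuous_on_def)
qed

section \<open>The subproblem as a projection\<close>

text \<open>
  The subproblem's feasible region as a set of full vectors, frozen at \<open>x\<close> outside \<open>J\<close>, so that the
  theory of projections in Euclidean space applies.
\<close>
definition block_set :: "real ^ 'n \<Rightarrow> real ^ 'n \<Rightarrow> real ^ 'n \<Rightarrow> 'n::finite set \<Rightarrow> real ^ 'n \<Rightarrow> (real ^ 'n) set"
  where "block_set a e g J x =
    {v. a \<bullet> v = a \<bullet> x \<and> (\<forall>j. if j \<in> J then e $ j \<le> v $ j \<and> v $ j \<le> g $ j else v $ j = x $ j)}"

lemma closed_block_set: "closed (block_set a e g J x)"
proof -
  have "block_set a e g J x = {v. a \<bullet> v = a \<bullet> x} \<inter>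
      (\<Inter>j\<in>J. {v. e $ j \<le> v $ j} \<inter> {v. v $ j \<le> g $ j}) \<inter> (\<Inter>j\<in>-J. {v. v $ j = x $ j})"
    by (auto simp: block_set_def)
  moreover have "closed \<dots>"
    by (intro closed_Int closed_INT ballI closed_Collect_eq closed_Collect_le continuous_intros)
  ultimately show ?thesis by simp
qed

lemma convex_block_set: "convex (block_set a e g J x)"
proof -
  have "block_set a e g J x = {v. a \<bullet> v = a \<bullet> x} \<inter>
      (\<Inter>j\<in>J. {v. axis j 1 \<bullet> v \<ge> e $ j} \<inter> {v. axis j 1 \<bullet> v \<le> g $ j}) \<inter>
      (\<Inter>j\<in>-J. {v. axis j 1 \<bullet> v = x $ j})"
    by (auto simp: block_set_def inner_axis')
  moreover have "convex \<dots>"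
    by (intro convex_Int convex_INT ballI convex_hyperplane convex_halfspace_ge convex_halfspace_le)
  ultimately show ?thesis by simp
qed

lemma feasible_mem_block_set: "x \<in> feasible_set a b e g \<Longrightarrow> x \<in> block_set a e g J x"
  by (auto simp: feasible_set_def block_set_def)

lemma block_set_subset_feasible:
  assumes x: "x \<in> feasible_set a b e g"
  shows "block_set a e g J x \<subseteq> feasible_set a b e g"
proof
  fix v assume v: "v \<in> block_set a e g J x"
  have "e $ j \<le> v $ j \<and> v $ j \<le> g $ j" for j
    using x v by (cases "j \<in> J") (auto simp: feasible_set_def block_set_def dest!: spec[of _ j])
  moreover have "a \<bullet> v = b"
    using x v by (simp add: feasible_set_def block_set_def)
  ultimately show "v \<in> feasible_set a b e g"
    by (simp add: feasible_set_def)
qed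

lemma sum_split_block:
  fixes v x :: "real ^ 'n::finite"
  assumes "\<And>j. j \<notin> J \<Longrightarrow> v $ j = x $ j"
  shows "a \<bullet> v - a \<bullet> x = (\<Sum>j\<in>J. a $ j * v $ j) - (\<Sum>j\<in>J. a $ j * x $ j)"
proof -
  have "a \<bullet> v - a \<bullet> x = (\<Sum>j\<in>UNIV. a $ j * (v $ j - x $ j))"
    by (simp add: inner_vec_def sum_subtractf right_diff_distrib)
  also have "\<dots> = (\<Sum>j\<in>J. a $ j * (v $ j - x $ j))"
    using assms by (intro sum.mono_neutral_right) auto
  finally show ?thesis
    by (simp add: sum_subtractf right_diff_distrib)
qed

definition glue :: "'n::finite set \<Rightarrow> real ^ 'n \<Rightarrow> ('n \<Rightarrow> real) \<Rightarrow> real ^ 'n" where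
  "glue J x u = (\<chi> j. if j \<in> J then u j else x $ j)"

lemma glue_mem_block_set:
  assumes "u \<in> subproblem_feasible a e g J x"
  shows "glue J x u \<in> block_set a e g J x"
proof -
  have "a \<bullet> glue J x u - a \<bullet> x = 0"
    using assms by (subst sum_split_block[where J = J]) (auto simp: glue_def subproblem_feasible_def)
  then show ?thesis
    using assms by (auto simp: block_set_def glue_def subproblem_feasible_def)
qed

lemma restrict_mem_subproblem_feasible:
  assumes "v \<in> block_set a e g J x"
  shows "restrict (($) v) J \<in> subproblem_feasible a e g J x"
proof -
  have "(\<Sum>j\<in>J. a $ j * v $ j) - (\<Sum>j\<in>J. a $ j * x $ j) = 0"
    using assms by (subst sum_split_block[symmetric]) (auto simp: block_set_def split: if_splits)
  then show ?thesis
    using assms by (auto simp: block_set_def subproblem_feasible_def cong: sum.cong)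
qed

lemma glue_restrict: "v \<in> block_set a e g J x \<Longrightarrow> glue J x (restrict (($) v) J) = v"
  by (auto simp: glue_def block_set_def vec_eq_iff)

text \<open>
  Completing the square: with \<open>p = \<nabla>\<^sub>J f(x)\<close> and \<open>s\<close> the displacement,
  \<open>p \<bullet> s + L/2 \<parallel>s\<parallel>\<^sup>2 = L/2 \<parallel>s + p/L\<parallel>\<^sup>2 - \<parallel>p\<parallel>\<^sup>2/(2L)\<close>.
\<close>
lemma subproblem_objective_eq_dist:
  fixes f :: "real ^ 'n::finite \<Rightarrow> real"
  assumes L: "L J > 0"
  shows "subproblem_objective f L J x u =
    L J / 2 * (dist (x - (1 / L J) *\<^sub>R coord_gradient f J x) (glue J x u))\<^sup>2
      - (norm (coord_gradient f J x))\<^sup>2 / (2 * L J)"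
proof -
  let ?p = "coord_gradient f J x"
  let ?s = "glue J x u - x"
  have 1: "(\<Sum>j\<in>J. partial_deriv f x j * (u j - x $ j)) = ?p \<bullet> ?s"
    unfolding inner_vec_def
    by (rule sum.mono_neutral_cong_left) (auto simp: coord_gradient_def glue_def)
  have 2: "(\<Sum>j\<in>J. (u j - x $ j)\<^sup>2) = ?s \<bullet> ?s"
    unfolding inner_vec_def
    by (rule sum.mono_neutral_cong_left) (auto simp: glue_def power2_eq_square)
  have "(dist (x - (1 / L J) *\<^sub>R ?p) (glue J x u))\<^sup>2 = (norm (?s + (1 / L J) *\<^sub>R ?p))\<^sup>2"
    by (simp add: dist_norm norm_minus_commute algebra_simps)
  also have "\<dots> = (?s + (1 / L J) *\<^sub>R ?p) \<bullet> (?s + (1 / L J) *\<^sub>R ?p)"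
    by (rule power2_norm_eq_inner)
  also have "\<dots> = ?s \<bullet> ?s + 2 / L J * (?p \<bullet> ?s) + (?p \<bullet> ?p) / (L J)\<^sup>2"
    by (simp only: inner_add_left inner_add_right inner_scaleR_left inner_scaleR_right
        inner_commute[of ?s ?p]) (simp add: power2_eq_square add_divide_distrib)
  finally have 3: "(dist (x - (1 / L J) *\<^sub>R ?p) (glue J x u))\<^sup>2
      = ?s \<bullet> ?s + 2 / L J * (?p \<bullet> ?s) + (?p \<bullet> ?p) / (L J)\<^sup>2" .
  show ?thesis
    unfolding subproblem_objective_def 1 2 3 power2_norm_eq_inner
    using L by (simp add: field_simps power2_eq_square)
qed

text \<open>
  Extensional functions on \<open>J\<close> and vectors agreeing with \<open>x\<close> outside \<open>J\<close> correspond via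
  \<open>restrict\<close> and \<open>glue\<close>, and the objective is an increasing function of the distance to the
  gradient step. Existence and uniqueness of the minimizer, needed to evaluate the definite
  description, are thus those of the nearest point in a closed convex set.
\<close>
lemma step_eq_closest_point:
  fixes f :: "real ^ 'n::finite \<Rightarrow> real"
  assumes L: "L J > 0" and x: "x \<in> feasible_set a b e g"
  shows "x + direction f L a e g J x =
    closest_point (block_set a e g J x) (x - (1 / L J) *\<^sub>R coord_gradient f J x)"
proof -
  let ?S = "block_set a e g J x" and ?c = "x - (1 / L J) *\<^sub>R coord_gradient f J x"
  let ?F = "subproblem_feasible a e g J x" and ?obj = "subproblem_objective f L J x"
  define v where "v = closest_point ?S ?c"
  define u where "u = restrict (($) v) J"
  have v: "v \<in> ?S"
    unfolding v_def using feasible_mem_block_set[OF x, of J]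
    by (intro closest_point_in_set closed_block_set) blast
  have u: "u \<in> ?F"
    unfolding u_def using v by (rule restrict_mem_subproblem_feasible)
  have glue_u: "glue J x u = v"
    unfolding u_def using v by (rule glue_restrict)
  have obj_less_iff: "?obj u1 < ?obj u2 \<longleftrightarrow> dist ?c (glue J x u1) < dist ?c (glue J x u2)" for u1 u2
  proof -
    have "?obj u1 < ?obj u2 \<longleftrightarrow> (dist ?c (glue J x u1))\<^sup>2 < (dist ?c (glue J x u2))\<^sup>2"
      using L by (simp add: subproblem_objective_eq_dist[of L J, OF L])
    also have "\<dots> \<longleftrightarrow> dist ?c (glue J x u1) < dist ?c (glue J x u2)"
      using power2_less_imp_less[OF _ zero_le_dist] power_strict_mono[OF _ zero_le_dist pos2] by blast
    finally show ?thesis .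
  qed
  have min: "is_arg_min ?obj (\<lambda>u. u \<in> ?F) u"
    unfolding is_arg_min_def obj_less_iff glue_u
    using u closest_point_le[OF closed_block_set glue_mem_block_set, of _ a e g J x ?c]
    by (auto simp: v_def not_less)
  have unique: "u' = u" if "is_arg_min ?obj (\<lambda>u. u \<in> ?F) u'" for u'
  proof -
    have u': "u' \<in> ?F" and le: "dist ?c (glue J x u') \<le> dist ?c v"
      using that u unfolding is_arg_min_def obj_less_iff glue_u[symmetric] by auto
    have "\<forall>z\<in>?S. dist ?c (glue J x u') \<le> dist ?c z"
      using le closest_point_le[OF closed_block_set, of _ a e g J x ?c] v_def by fastforce
    then have glue_u': "glue J x u' = v"
      unfolding v_def
      by (intro closest_point_unique convex_block_set closed_block_set glue_mem_block_set u')
    have "u' j = u j" if "j \<in> J" for j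
      using arg_cong[OF glue_u', of "\<lambda>y. y $ j"] that by (simp add: u_def glue_def)
    moreover have "u' j = u j" if "j \<notin> J" for j
      using that u u' by (auto simp: subproblem_feasible_def extensional_def)
    ultimately show ?thesis by auto
  qed
  have "subproblem_solution f L a e g J x = u"
    unfolding subproblem_solution_def using min unique by (rule the_equality)
  then have "x + direction f L a e g J x = glue J x u"
    by (auto simp: direction_def glue_def vec_eq_iff)
  with glue_u show ?thesis by (simp add: v_def)
qed

lemma step_mem_block_set:
  fixes f :: "real ^ 'n::finite \<Rightarrow> real"
  assumes "L J > 0" and "x \<in> feasible_set a b e g"
  shows "x + direction f L a e g J x \<in> block_set a e g J x"
  unfolding step_eq_closest_point[of L J, OF assms]
  using feasible_mem_block_set[OF assms(2), of J]
  by (intro closest_point_in_set closed_block_set) blast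

lemma step_variational_inequality:
  fixes f :: "real ^ 'n::finite \<Rightarrow> real"
  assumes L: "L J > 0" and x: "x \<in> feasible_set a b e g"
    and v: "x + s \<in> block_set a e g J x"
  shows "(coord_gradient f J x + L J *\<^sub>R direction f L a e g J x) \<bullet> (s - direction f L a e g J x) \<ge> 0"
proof -
  let ?p = "coord_gradient f J x" and ?d = "direction f L a e g J x"
  have "(x - (1 / L J) *\<^sub>R ?p - (x + ?d)) \<bullet> (x + s - (x + ?d)) \<le> 0"
    unfolding step_eq_closest_point[of L J, OF L x]
    by (intro closest_point_dot convex_block_set closed_block_set v)
  then have "((1 / L J) *\<^sub>R (?p + L J *\<^sub>R ?d)) \<bullet> (s - ?d) \<ge> 0"
    using L by (simp add: algebra_simps)
  then show ?thesis
    using L by (simp add: zero_le_divide_iff zero_le_mult_iff)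
qed

text \<open>
  Not moving is feasible, and the variational inequality at that competitor yields
  \<open>\<nabla>\<^sub>J f(x) \<bullet> d \<le> - L \<parallel>d\<parallel>\<^sup>2\<close>; the quadratic term of the descent inequality gives back at most half
  of that.
\<close>
lemma step_descent:
  fixes f :: "real ^ 'n::finite \<Rightarrow> real"
  assumes diff: "\<And>x. f differentiable (at x)"
    and Lip: "coord_Lipschitz_gradient q L f" and J: "J \<in> coord_sets q"
    and x: "x \<in> feasible_set a b e g"
  shows "f (x + direction f L a e g J x) \<le> f x - L J / 2 * (norm (direction f L a e g J x))\<^sup>2"
proof -
  let ?p = "coord_gradient f J x" and ?d = "direction f L a e g J x"
  have L: "L J > 0"
    by (rule coord_Lipschitz_pos[OF Lip J])
  have "(?p + L J *\<^sub>R ?d) \<bullet> (0 - ?d) \<ge> 0"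
    using feasible_mem_block_set[OF x] by (intro step_variational_inequality[of L J, OF L x]) simp
  then have "?p \<bullet> ?d \<le> - L J * (norm ?d)\<^sup>2"
    by (simp add: power2_norm_eq_inner inner_add_left)
  moreover have "f (x + ?d) \<le> f x + ?p \<bullet> ?d + L J / 2 * (norm ?d)\<^sup>2"
    by (rule descent_inequality[OF diff Lip J]) (simp add: direction_def)
  ultimately show ?thesis by simp
qed

section \<open>Behaviour along a fixed sequence of draws\<close>

lemma rccd_feasible:
  fixes f :: "real ^ 'n::finite \<Rightarrow> real"
  assumes "x0 \<in> feasible_set a b e g" and "\<And>m. L (J m) > 0"
  shows "rccd f L a e g x0 J m \<in> feasible_set a b e g"
proof (induction m)
  case (Suc m)
  then show ?case
    using step_mem_block_set[of L, OF assms(2) Suc] block_set_subset_feasible[OF Suc] by auto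
qed (use assms in simp)

text \<open>The iterate at time \<open>m\<close> is a function of the past draws, hence independent of draw \<open>m\<close>.\<close>
lemma rccd_cong:
  assumes "\<And>k. k < m \<Longrightarrow> J k = J' k"
  shows "rccd f L a e g x0 J m = rccd f L a e g x0 J' m"
  using assms by (induction m) auto

lemma compact_feasible_set: "compact (feasible_set a b e g)"
proof -
  have "feasible_set a b e g = cbox e g \<inter> {x. a \<bullet> x = b}"
    by (auto simp: feasible_set_def mem_box_cart)
  then show ?thesis
    by (simp add: compact_Int_closed compact_cbox closed_hyperplane)
qed

text \<open>
  The bound is the gap between \<open>f x0\<close> and the minimum of \<open>f\<close> over the compact feasible set. It is
  obtained before the draws are chosen, so that it can serve as a constant in an integral over all
  sample paths.
\<close>
lemma sum_steps_bounded:
  fixes f :: "real ^ 'n::finite \<Rightarrow> real"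
  assumes diff: "\<And>x. f differentiable (at x)"
    and Lip: "coord_Lipschitz_gradient q L f"
    and x0: "x0 \<in> feasible_set a b e g"
  obtains C where "\<And>J n. (\<And>m. J m \<in> coord_sets q) \<Longrightarrow>
    (\<Sum>m<n. L (J m) / 2 * (norm (direction f L a e g (J m) (rccd f L a e g x0 J m)))\<^sup>2) \<le> C"
proof -
  have "continuous_on (feasible_set a b e g) f"
    using diff by (intro continuous_at_imp_continuous_on ballI differentiable_imp_continuous_within) auto
  then obtain y where y: "\<And>x. x \<in> feasible_set a b e g \<Longrightarrow> f y \<le> f x"
    using continuous_attains_inf[OF compact_feasible_set] x0 by (metis empty_iff)
  show ?thesis
  proof
    fix J :: "nat \<Rightarrow> 'n set" and n
    assume J: "\<And>m. J m \<in> coord_sets q"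
    have L: "L (J m) > 0" for m
      by (rule coord_Lipschitz_pos[OF Lip J])
    let ?x = "rccd f L a e g x0 J"
    have feas: "?x m \<in> feasible_set a b e g" for m
      by (rule rccd_feasible[of x0 a b e g L J, OF x0 L])
    have "(\<Sum>m<n. L (J m) / 2 * (norm (direction f L a e g (J m) (?x m)))\<^sup>2)
        \<le> (\<Sum>m<n. f (?x m) - f (?x (Suc m)))"
      using step_descent[OF diff Lip J feas] by (intro sum_mono) (simp add: le_diff_eq add.commute)
    also have "\<dots> = f x0 - f (?x n)"
      by (subst sum_lessThan_telescope') simp
    also have "\<dots> \<le> f x0 - f y"
      using y[OF feas] by simp
    finally show "(\<Sum>m<n. L (J m) / 2 * (norm (direction f L a e g (J m) (?x m)))\<^sup>2) \<le> f x0 - f y" .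
  qed
qed

section \<open>From drawn blocks to all blocks\<close>

text \<open>
  A function of the first \<open>m\<close> draws factors through the restriction of the draws to \<open>{..<m}\<close>. The
  draws take finitely many values, so the product space of the first \<open>m\<close> draws is discrete and
  every function on it is measurable.
\<close>
lemma (in prob_space) nn_integral_history_indep:
  fixes X :: "nat \<Rightarrow> 'a \<Rightarrow> 'b::finite" and h :: "(nat \<Rightarrow> 'b) \<Rightarrow> ennreal"
  assumes indep: "indep_vars (\<lambda>_. count_space UNIV) X UNIV"
    and hist: "\<And>s s'. (\<And>k. k < m \<Longrightarrow> s k = s' k) \<Longrightarrow> h s = h s'"
  shows "(\<lambda>\<omega>. h (\<lambda>k. X k \<omega>)) \<in> borel_measurable M" (is ?meas)
    and "(\<integral>\<^sup>+ \<omega>. indicator {c} (X m \<omega>) * h (\<lambda>k. X k \<omega>) \<partial>M)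
      = emeasure M {\<omega> \<in> space M. X m \<omega> = c} * (\<integral>\<^sup>+ \<omega>. h (\<lambda>k. X k \<omega>) \<partial>M)" (is ?prod)
proof -
  have rv: "X k \<in> measurable M (count_space UNIV)" for k
    using indep unfolding indep_vars_def by auto
  have PiM_eq: "PiM A (\<lambda>_. count_space (UNIV :: 'b set)) = count_space (PiE A (\<lambda>_. UNIV))"
    if "finite A" for A :: "nat set"
    using that by (intro count_space_PiM_finite) auto
  let ?R = "\<lambda>A \<omega>. restrict (\<lambda>i. X i \<omega>) A"
  have "indep_var (PiM {m} (\<lambda>_. count_space UNIV)) (?R {m}) (PiM {..<m} (\<lambda>_. count_space UNIV)) (?R {..<m})"
    using indep by (rule indep_var_restrict) auto
  then have "indep_var borel ((\<lambda>s. indicator {c} (s m) :: ennreal) \<circ> ?R {m}) borel (h \<circ> ?R {..<m})"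
    by (rule indep_var_compose) (auto simp: PiM_eq)
  moreover have "(\<lambda>s. indicator {c} (s m) :: ennreal) \<circ> ?R {m} = (\<lambda>\<omega>. indicator {c} (X m \<omega>))"
    by (auto simp: fun_eq_iff)
  moreover have "h \<circ> ?R {..<m} = (\<lambda>\<omega>. h (\<lambda>k. X k \<omega>))"
    by (auto simp: fun_eq_iff intro!: hist)
  ultimately have ind: "indep_var borel (\<lambda>\<omega>. indicator {c} (X m \<omega>) :: ennreal) borel (\<lambda>\<omega>. h (\<lambda>k. X k \<omega>))"
    by simp
  then show ?meas
    using indep_var_rv2 by blast
  let ?Y = "\<lambda>i \<omega>. case_bool (indicator {c} (X m \<omega>) :: ennreal) (h (\<lambda>k. X k \<omega>)) i"
  have "(\<lambda>i. case_bool borel borel i) = (\<lambda>_. borel :: ennreal measure)"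
    by (auto simp: fun_eq_iff split: bool.split)
  moreover have "case_bool (\<lambda>\<omega>. indicator {c} (X m \<omega>) :: ennreal) (\<lambda>\<omega>. h (\<lambda>k. X k \<omega>)) = ?Y"
    by (auto simp: fun_eq_iff split: bool.split)
  ultimately have "indep_vars (\<lambda>_. borel) ?Y UNIV"
    using ind unfolding indep_var_def by simp
  then have "(\<integral>\<^sup>+\<omega>. (\<Prod>i\<in>UNIV. ?Y i \<omega>) \<partial>M) = (\<Prod>i\<in>UNIV. \<integral>\<^sup>+\<omega>. ?Y i \<omega> \<partial>M)"
    by (intro indep_vars_nn_integral) auto
  then have "(\<integral>\<^sup>+ \<omega>. indicator {c} (X m \<omega>) * h (\<lambda>k. X k \<omega>) \<partial>M)
      = (\<integral>\<^sup>+\<omega>. indicator {c} (X m \<omega>) \<partial>M) * (\<integral>\<^sup>+ \<omega>. h (\<lambda>k. X k \<omega>) \<partial>M)"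
    by (simp add: UNIV_bool mult.commute)
  moreover have "(\<integral>\<^sup>+\<omega>. indicator {c} (X m \<omega>) \<partial>M) = (\<integral>\<^sup>+\<omega>. indicator {\<omega>\<in>space M. X m \<omega> = c} \<omega> \<partial>M)"
    by (rule nn_integral_cong) (auto simp: indicator_def)
  moreover have "{\<omega>\<in>space M. X m \<omega> = c} \<in> sets M"
    using rv by measurable
  ultimately show ?prod
    by simp
qed

text \<open>
  The step from drawn blocks to all blocks. Integrating termwise, each term on the drawn times
  picks up the factor \<open>p\<close> by independence, so the full series has integral at most \<open>C / p\<close> and is
  finite almost everywhere. The event \<open>X m = c\<close> thus cannot systematically avoid the times at which
  \<open>h m\<close> is large.
\<close>
lemma (in prob_space) AE_suminf_history_finite:
  fixes X :: "nat \<Rightarrow> 'a \<Rightarrow> 'b::finite" and h :: "nat \<Rightarrow> (nat \<Rightarrow> 'b) \<Rightarrow> ennreal"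
  assumes indep: "indep_vars (\<lambda>_. count_space UNIV) X UNIV"
    and prob: "\<And>m. emeasure M {\<omega> \<in> space M. X m \<omega> = c} = p" and p: "p > 0"
    and hist: "\<And>m s s'. (\<And>k. k < m \<Longrightarrow> s k = s' k) \<Longrightarrow> h m s = h m s'"
    and bound: "AE \<omega> in M. (\<Sum>m. indicator {c} (X m \<omega>) * h m (\<lambda>k. X k \<omega>)) \<le> C" and C: "C < \<infinity>"
  shows "AE \<omega> in M. (\<Sum>m. h m (\<lambda>k. X k \<omega>)) \<noteq> \<infinity>"
proof -
  have [measurable]: "X m \<in> measurable M (count_space UNIV)" for m
    using indep unfolding indep_vars_def by auto
  have [measurable]: "(\<lambda>\<omega>. h m (\<lambda>k. X k \<omega>)) \<in> borel_measurable M" for m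
    by (rule nn_integral_history_indep(1)[OF indep hist])
  have term_eq: "(\<integral>\<^sup>+ \<omega>. indicator {c} (X m \<omega>) * h m (\<lambda>k. X k \<omega>) \<partial>M)
      = p * (\<integral>\<^sup>+ \<omega>. h m (\<lambda>k. X k \<omega>) \<partial>M)" for m
    unfolding prob[of m, symmetric] by (rule nn_integral_history_indep(2)[OF indep hist])
  have "p * (\<integral>\<^sup>+ \<omega>. (\<Sum>m. h m (\<lambda>k. X k \<omega>)) \<partial>M) = (\<Sum>m. p * (\<integral>\<^sup>+ \<omega>. h m (\<lambda>k. X k \<omega>) \<partial>M))"
    by (subst nn_integral_suminf) auto
  also have "\<dots> = (\<Sum>m. \<integral>\<^sup>+ \<omega>. indicator {c} (X m \<omega>) * h m (\<lambda>k. X k \<omega>) \<partial>M)"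
    by (simp only: term_eq)
  also have "\<dots> = (\<integral>\<^sup>+ \<omega>. (\<Sum>m. indicator {c} (X m \<omega>) * h m (\<lambda>k. X k \<omega>)) \<partial>M)"
    by (subst nn_integral_suminf) auto
  also have "\<dots> \<le> (\<integral>\<^sup>+ \<omega>. C \<partial>M)"
    using bound by (rule nn_integral_mono_AE)
  also have "\<dots> < \<infinity>"
    using C by (simp add: emeasure_space_1)
  finally have "(\<integral>\<^sup>+ \<omega>. (\<Sum>m. h m (\<lambda>k. X k \<omega>)) \<partial>M) \<noteq> \<infinity>"
    using p by (auto simp: ennreal_mult_eq_top_iff)
  then show ?thesis
    by (intro nn_integral_noteq_infinite) auto
qed

lemma
  fixes J :: "nat \<Rightarrow> 'w \<Rightarrow> 'n::finite set"
  assumes "prob_space M" and draws: "uniform_draws M q J" and q: "q \<le> CARD('n)"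
  shows AE_draws_coord_sets: "AE w in M. \<forall>m. J m w \<in> coord_sets q"
    and emeasure_draw_eq: "S \<in> coord_sets q \<Longrightarrow>
      emeasure M {w \<in> space M. J m w = S} = ennreal (1 / card (coord_sets q :: 'n set set))"
proof -
  interpret prob_space M by fact
  have rv: "J k \<in> measurable M (count_space UNIV)" for k
    using draws unfolding uniform_draws_def indep_vars_def by auto
  obtain S0 :: "'n set" where "card S0 = q"
    using obtain_subset_with_card_n[OF q] by blast
  then have ne: "(coord_sets q :: 'n set set) \<noteq> {}"
    by (auto simp: coord_sets_def)
  have distr: "emeasure M {w \<in> space M. J m w \<in> A} = emeasure (measure_pmf (pmf_of_set (coord_sets q))) A"
    for m A
  proof -
    have "emeasure (measure_pmf (pmf_of_set (coord_sets q))) A = emeasure (distr M (count_space UNIV) (J m)) A"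
      using draws unfolding uniform_draws_def by simp
    also have "\<dots> = emeasure M (J m -` A \<inter> space M)"
      using rv by (intro emeasure_distr) auto
    finally show ?thesis
      by (simp add: vimage_def Int_def conj_commute)
  qed
  show "AE w in M. \<forall>m. J m w \<in> coord_sets q"
    unfolding AE_all_countable
  proof
    fix m
    have "emeasure M {w \<in> space M. J m w \<in> - coord_sets q} = 0"
      unfolding distr using ne by (subst emeasure_pmf_of_set) auto
    moreover have "{w \<in> space M. J m w \<in> - coord_sets q} \<in> sets M"
      using rv by measurable
    ultimately show "AE w in M. J m w \<in> coord_sets q"
      by (subst AE_iff_measurable[OF _ refl]) auto
  qed
  show "emeasure M {w \<in> space M. J m w = S} = ennreal (1 / card (coord_sets q :: 'n set set))"
    if "S \<in> coord_sets q"
    using distr[of m "{S}"] ne that by (simp add: emeasure_pmf_of_set)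
qed

section \<open>Stationarity\<close>

text \<open>
  A displacement \<open>w\<close> that is feasible at \<open>z\<close> need not be feasible at nearby points \<open>X k\<close>, so the
  inequality cannot be passed to the limit with \<open>w\<close> itself. Half of it works: where \<open>w\<^sub>j > 0\<close>, the
  coordinate \<open>z\<^sub>j\<close> is at least \<open>w\<^sub>j\<close> below its upper bound, which leaves room \<open>w\<^sub>j / 2\<close> for the error of
  \<open>X k\<close>; where \<open>w\<^sub>j = 0\<close>, feasibility of \<open>X k\<close> itself suffices. The factor does not matter for
  the sign.
\<close>
lemma limit_variational_inequality:
  fixes f :: "real ^ 'n::finite \<Rightarrow> real"
  assumes cont: "continuous_on UNIV (gradient f)" and L: "L J > 0"
    and X: "\<And>k. X k \<in> feasible_set a b e g" and lim: "X \<longlonglongrightarrow> z"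
    and d0: "(\<lambda>k. direction f L a e g J (X k)) \<longlonglongrightarrow> 0"
    and w: "\<And>j. j \<notin> J \<Longrightarrow> w $ j = 0" "a \<bullet> w = 0"
    and box: "\<And>j. e $ j \<le> z $ j + w $ j" "\<And>j. z $ j + w $ j \<le> g $ j"
  shows "gradient f z \<bullet> w \<ge> 0"
proof -
  let ?d = "\<lambda>k. direction f L a e g J (X k)"
  let ?s = "(1/2) *\<^sub>R w"
  have comp: "(\<lambda>k. X k $ j) \<longlonglongrightarrow> z $ j" for j
    using lim by (rule tendsto_vec_nth)
  have ev: "\<forall>\<^sub>F k in sequentially. e $ j \<le> (X k + ?s) $ j \<and> (X k + ?s) $ j \<le> g $ j" for j
  proof -
    have Xbox: "e $ j \<le> X k $ j" "X k $ j \<le> g $ j" for k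
      using X[of k] by (auto simp: feasible_set_def)
    consider "w $ j = 0" | "w $ j > 0" | "w $ j < 0" by linarith
    then show ?thesis
    proof cases
      case 1
      with Xbox show ?thesis by simp
    next
      case 2
      then have "\<forall>\<^sub>F k in sequentially. X k $ j < z $ j + w $ j / 2"
        by (intro order_tendstoD(2)[OF comp]) simp
      then show ?thesis
      proof eventually_elim
        case (elim k)
        then show ?case using 2 Xbox[of k] box(2)[of j] by simp
      qed
    next
      case 3
      then have "\<forall>\<^sub>F k in sequentially. X k $ j > z $ j + w $ j / 2"
        by (intro order_tendstoD(1)[OF comp]) simp
      then show ?thesis
      proof eventually_elim
        case (elim k)
        then show ?case using 3 Xbox[of k] box(1)[of j] by simp
      qed
    qed
  qed
  have "\<forall>\<^sub>F k in sequentially. \<forall>j. e $ j \<le> (X k + ?s) $ j \<and> (X k + ?s) $ j \<le> g $ j"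
    using ev by (rule eventually_all_finite)
  then have "\<forall>\<^sub>F k in sequentially. 0 \<le> gradient f (X k) \<bullet> (?s - ?d k) + (L J *\<^sub>R ?d k) \<bullet> (?s - ?d k)"
  proof eventually_elim
    case (elim k)
    then have "X k + ?s \<in> block_set a e g J (X k)"
      using w by (auto simp: block_set_def inner_add_right)
    then have "0 \<le> (coord_gradient f J (X k) + L J *\<^sub>R ?d k) \<bullet> (?s - ?d k)"
      by (rule step_variational_inequality[of L J, OF L X])
    moreover have "coord_gradient f J (X k) \<bullet> (?s - ?d k) = gradient f (X k) \<bullet> (?s - ?d k)"
      by (rule gradient_inner_supported[symmetric]) (simp add: w direction_def)
    ultimately show ?case by (simp add: inner_add_left)
  qed
  moreover have "(\<lambda>k. gradient f (X k)) \<longlonglongrightarrow> gradient f z"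
    using cont lim by (auto intro: continuous_on_tendsto_compose)
  then have "(\<lambda>k. gradient f (X k) \<bullet> (?s - ?d k) + (L J *\<^sub>R ?d k) \<bullet> (?s - ?d k))
      \<longlonglongrightarrow> gradient f z \<bullet> (?s - 0) + (L J *\<^sub>R 0) \<bullet> (?s - 0)"
    using d0 by (intro tendsto_intros)
  ultimately have "0 \<le> gradient f z \<bullet> (?s - 0) + (L J *\<^sub>R 0) \<bullet> (?s - 0)"
    by (intro tendsto_lowerbound) auto
  then show ?thesis by simp
qed

lemma exists_between_finite_sets:
  fixes A B :: "real set"
  assumes "finite A" "finite B" "\<And>x y. x \<in> A \<Longrightarrow> y \<in> B \<Longrightarrow> x \<le> y"
  obtains l where "\<And>x. x \<in> A \<Longrightarrow> x \<le> l" "\<And>y. y \<in> B \<Longrightarrow> l \<le> y"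
proof (cases "A = {}")
  case True
  show ?thesis
  proof (cases "B = {}")
    case True
    with \<open>A = {}\<close> show ?thesis by (intro that) auto
  next
    case False
    with \<open>A = {}\<close> assms show ?thesis by (intro that[of "Min B"]) auto
  qed
next
  case False
  with assms show ?thesis by (intro that[of "Max A"]) auto
qed

text \<open>
  A multiplier \<open>l\<close> is suitable iff \<open>r\<^sub>k = \<nabla>f(z)\<^sub>k + l a\<^sub>k\<close> is nonnegative whenever \<open>z\<^sub>k\<close> can increase and
  nonpositive whenever it can decrease; then \<open>\<gamma>\<close> and \<open>\<delta>\<close> are the positive and negative parts of \<open>r\<close>.
  If \<open>a\<^sub>k = 0\<close>, the condition is free of \<open>l\<close> and follows from moving coordinate \<open>k\<close> alone. Otherwise
  it reads \<open>\<rho>\<^sub>k \<le> l\<close> if \<open>a\<^sub>k z\<^sub>k\<close> can increase and \<open>l \<le> \<rho>\<^sub>k\<close> if it can decrease, with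
  \<open>\<rho>\<^sub>k = - \<nabla>f(z)\<^sub>k / a\<^sub>k\<close>. A lower bound \<open>\<rho>\<^sub>i\<close> never exceeds an upper bound \<open>\<rho>\<^sub>j\<close> because increasing
  \<open>a\<^sub>i z\<^sub>i\<close> while decreasing \<open>a\<^sub>j z\<^sub>j\<close> by the same amount respects the equality constraint.
\<close>
lemma stationary_point_if_pairwise:
  fixes f :: "real ^ 'n::finite \<Rightarrow> real"
  assumes z: "z \<in> feasible_set a b e g"
    and pair: "\<And>i j w. (\<And>k. k \<noteq> i \<Longrightarrow> k \<noteq> j \<Longrightarrow> w $ k = 0) \<Longrightarrow> a \<bullet> w = 0 \<Longrightarrow>
      (\<And>k. e $ k \<le> z $ k + w $ k) \<Longrightarrow> (\<And>k. z $ k + w $ k \<le> g $ k) \<Longrightarrow> gradient f z \<bullet> w \<ge> 0"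
  shows "stationary_point f a b e g z"
proof -
  let ?c = "gradient f z"
  have zbox: "e $ k \<le> z $ k" "z $ k \<le> g $ k" for k
    using z by (auto simp: feasible_set_def)
  (* a small move of coordinate k in the direction of the sign of \<sigma> stays within its bounds *)
  define ok where "ok k \<sigma> \<longleftrightarrow> (\<sigma> > 0 \<longrightarrow> z $ k < g $ k) \<and> (\<sigma> < 0 \<longrightarrow> e $ k < z $ k)" for k and \<sigma> :: real
  have room: "\<exists>\<tau>>0. \<forall>t. 0 \<le> t \<and> t \<le> \<tau> \<longrightarrow> e $ k \<le> z $ k + t * \<sigma> \<and> z $ k + t * \<sigma> \<le> g $ k"
    if "ok k \<sigma>" for k \<sigma>
  proof -
    consider "\<sigma> = 0" | "\<sigma> > 0" | "\<sigma> < 0" by linarith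
    then show ?thesis
    proof cases
      case 1
      with zbox show ?thesis by (intro exI[of _ 1]) auto
    next
      case 2
      show ?thesis
      proof (intro exI[of _ "(g $ k - z $ k) / \<sigma>"] conjI allI impI)
        show "(g $ k - z $ k) / \<sigma> > 0" using that 2 by (simp add: ok_def)
        fix t assume t: "0 \<le> t \<and> t \<le> (g $ k - z $ k) / \<sigma>"
        then show "z $ k + t * \<sigma> \<le> g $ k" using 2 by (simp add: field_simps)
        have "0 \<le> t * \<sigma>" using t 2 by simp
        then show "e $ k \<le> z $ k + t * \<sigma>" using zbox[of k] by linarith
      qed
    next
      case 3
      show ?thesis
      proof (intro exI[of _ "(e $ k - z $ k) / \<sigma>"] conjI allI impI)
        show "(e $ k - z $ k) / \<sigma> > 0" using that 3 by (simp add: ok_def divide_neg_neg)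
        fix t assume t: "0 \<le> t \<and> t \<le> (e $ k - z $ k) / \<sigma>"
        then show "e $ k \<le> z $ k + t * \<sigma>" using 3 by (simp add: field_simps)
        have "t * \<sigma> \<le> 0" using t 3 by (simp add: mult_nonneg_nonpos)
        then show "z $ k + t * \<sigma> \<le> g $ k" using zbox[of k] by linarith
      qed
    qed
  qed
  have single: "?c $ k * \<sigma> \<ge> 0" if k: "a $ k = 0" "ok k \<sigma>" for k \<sigma>
  proof -
    obtain \<tau> where \<tau>: "\<tau> > 0" "e $ k \<le> z $ k + \<tau> * \<sigma>" "z $ k + \<tau> * \<sigma> \<le> g $ k"
      using room[OF k(2)] by (metis order_refl less_imp_le)
    have "?c \<bullet> axis k (\<tau> * \<sigma>) \<ge> 0"
    proof (rule pair[of k k])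
      show "a \<bullet> axis k (\<tau> * \<sigma>) = 0"
        using k(1) by (simp add: inner_axis)
    qed (use \<tau> zbox in \<open>auto simp: axis_def\<close>)
    then have "\<tau> * (?c $ k * \<sigma>) \<ge> 0"
      by (simp add: inner_axis mult.left_commute)
    then show ?thesis
      using \<tau>(1) by (simp add: zero_le_mult_iff)
  qed
  have double: "?c $ i / a $ i \<ge> ?c $ j / a $ j"
    if ij: "a $ i \<noteq> 0" "a $ j \<noteq> 0" "ok i (1 / a $ i)" "ok j (- 1 / a $ j)" for i j
  proof (cases "i = j")
    case False
    obtain \<tau>1 where \<tau>1: "\<tau>1 > 0"
      "\<forall>t. 0 \<le> t \<and> t \<le> \<tau>1 \<longrightarrow> e $ i \<le> z $ i + t * (1 / a $ i) \<and> z $ i + t * (1 / a $ i) \<le> g $ i"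
      using room[OF ij(3)] by blast
    obtain \<tau>2 where \<tau>2: "\<tau>2 > 0"
      "\<forall>t. 0 \<le> t \<and> t \<le> \<tau>2 \<longrightarrow> e $ j \<le> z $ j + t * (- 1 / a $ j) \<and> z $ j + t * (- 1 / a $ j) \<le> g $ j"
      using room[OF ij(4)] by blast
    define \<tau> where "\<tau> = min \<tau>1 \<tau>2"
    have \<tau>: "\<tau> > 0" "\<tau> \<le> \<tau>1" "\<tau> \<le> \<tau>2"
      using \<tau>1(1) \<tau>2(1) by (auto simp: \<tau>_def)
    let ?w = "axis i (\<tau> * (1 / a $ i)) + axis j (\<tau> * (- 1 / a $ j)) :: real ^ 'n"
    have wk: "?w $ k = (if k = i then \<tau> * (1 / a $ i) else if k = j then \<tau> * (- 1 / a $ j) else 0)" for k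
      using False by (auto simp: axis_def)
    have b: "e $ k \<le> z $ k + ?w $ k \<and> z $ k + ?w $ k \<le> g $ k" for k
      unfolding wk using \<tau>1(2) \<tau>2(2) \<tau> zbox[of k] by auto
    have "?c \<bullet> ?w \<ge> 0"
    proof (rule pair[of i j])
      show "a \<bullet> ?w = 0"
        using ij by (simp add: inner_add_right inner_axis)
      show "?w $ k = 0" if "k \<noteq> i" "k \<noteq> j" for k
        unfolding wk using that by simp
    qed (fact conjunct1[OF b] conjunct2[OF b])+
    then have "\<tau> * (?c $ i / a $ i - ?c $ j / a $ j) \<ge> 0"
      by (simp add: inner_add_right inner_axis algebra_simps)
    then show ?thesis
      using \<tau>(1) by (simp add: zero_le_mult_iff)
  qed simp
  define \<rho> where "\<rho> k = - (?c $ k / a $ k)" for k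
  obtain l where l: "\<And>i. a $ i \<noteq> 0 \<Longrightarrow> ok i (1 / a $ i) \<Longrightarrow> \<rho> i \<le> l"
    "\<And>j. a $ j \<noteq> 0 \<Longrightarrow> ok j (- 1 / a $ j) \<Longrightarrow> l \<le> \<rho> j"
  proof -
    let ?A = "{i. a $ i \<noteq> 0 \<and> ok i (1 / a $ i)}" and ?B = "{j. a $ j \<noteq> 0 \<and> ok j (- 1 / a $ j)}"
    have le: "x \<le> y" if xy: "x \<in> \<rho> ` ?A" "y \<in> \<rho> ` ?B" for x y
    proof -
      obtain i j where "i \<in> ?A" "j \<in> ?B" "x = \<rho> i" "y = \<rho> j"
        using xy by blast
      then show ?thesis
        using double[of i j] by (simp add: \<rho>_def)
    qed
    obtain l where lower: "\<And>x. x \<in> \<rho> ` ?A \<Longrightarrow> x \<le> l" and upper: "\<And>y. y \<in> \<rho> ` ?B \<Longrightarrow> l \<le> y"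
      by (rule exists_between_finite_sets[of "\<rho> ` ?A" "\<rho> ` ?B", OF _ _ le]) auto
    show ?thesis
    proof (rule that[of l])
      show "\<rho> i \<le> l" if i: "a $ i \<noteq> 0" "ok i (1 / a $ i)" for i
        by (rule lower) (use i in blast)
      show "l \<le> \<rho> j" if j: "a $ j \<noteq> 0" "ok j (- 1 / a $ j)" for j
        by (rule upper) (use j in blast)
    qed
  qed
  define r where "r k = ?c $ k + l * a $ k" for k
  have r: "(r k > 0 \<longrightarrow> z $ k = e $ k) \<and> (r k < 0 \<longrightarrow> z $ k = g $ k)" for k
  proof (cases "a $ k = 0")
    case True
    then show ?thesis
      using single[of k 1] single[of k "-1"] zbox[of k]
      by (cases "z $ k = e $ k"; cases "z $ k = g $ k") (auto simp: r_def ok_def less_le)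
  next
    case False
    have up: "r k \<ge> 0" if "ok k 1"
    proof (cases "a $ k > 0")
      case True
      then have "\<rho> k \<le> l" using that by (intro l(1)) (auto simp: ok_def)
      then show ?thesis using True by (simp add: \<rho>_def r_def field_simps)
    next
      case neg: False
      then have "l \<le> \<rho> k" using that \<open>a $ k \<noteq> 0\<close> by (intro l(2)) (auto simp: ok_def field_simps)
      then show ?thesis using neg \<open>a $ k \<noteq> 0\<close> by (simp add: \<rho>_def r_def field_simps)
    qed
    have down: "r k \<le> 0" if "ok k (-1)"
    proof (cases "a $ k > 0")
      case True
      then have "l \<le> \<rho> k" using that by (intro l(2)) (auto simp: ok_def)
      then show ?thesis using True by (simp add: \<rho>_def r_def field_simps)
    next
      case neg: False
      then have "\<rho> k \<le> l" using that \<open>a $ k \<noteq> 0\<close> by (intro l(1)) (auto simp: ok_def field_simps)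
      then show ?thesis using neg \<open>a $ k \<noteq> 0\<close> by (simp add: \<rho>_def r_def field_simps)
    qed
    show ?thesis
      using up down zbox[of k]
      by (cases "z $ k = e $ k"; cases "z $ k = g $ k") (auto simp: ok_def less_le)
  qed
  let ?gam = "\<chi> k. max (r k) 0" and ?del = "\<chi> k. max (- r k) 0"
  have "?c + l *\<^sub>R a - ?gam + ?del = 0"
    by (simp add: vec_eq_iff r_def max_def)
  moreover have "?gam $ k * (z $ k - e $ k) = 0 \<and> ?del $ k * (g $ k - z $ k) = 0" for k
    using r[of k] by (auto simp: max_def)
  moreover have "?gam $ k \<ge> 0 \<and> ?del $ k \<ge> 0" for k
    by simp
  ultimately show ?thesis
    using z unfolding stationary_point_def by blast
qed

lemma accumulation_point_stationary:
  fixes f :: "real ^ 'n::finite \<Rightarrow> real"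
  assumes q: "2 \<le> q" "q \<le> CARD('n)" and Lip: "coord_Lipschitz_gradient q L f"
    and X: "\<And>m. X m \<in> feasible_set a b e g"
    and d0: "\<And>J. J \<in> coord_sets q \<Longrightarrow> (\<lambda>m. direction f L a e g J (X m)) \<longlonglongrightarrow> 0"
    and z: "accumulation_point X z"
  shows "stationary_point f a b e g z"
proof -
  obtain r where r: "strict_mono r" "(X \<circ> r) \<longlonglongrightarrow> z"
    using z unfolding accumulation_point_def by auto
  have "z \<in> feasible_set a b e g"
    by (rule closed_sequentially[OF compact_imp_closed[OF compact_feasible_set] _ r(2)])
      (simp add: X)
  then show ?thesis
  proof (rule stationary_point_if_pairwise)
    fix i j w
    assume w: "\<And>k. k \<noteq> i \<Longrightarrow> k \<noteq> j \<Longrightarrow> w $ k = 0" "a \<bullet> w = 0"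
      "\<And>k. e $ k \<le> z $ k + w $ k" "\<And>k. z $ k + w $ k \<le> g $ k"
    have "card {i, j} \<le> q"
      using q by (simp add: card_insert_if)
    then obtain J where J: "{i, j} \<subseteq> J" "card J = q"
      using exists_subset_between[of "{i, j}" q UNIV] q by auto
    then have Jq: "J \<in> coord_sets q" by (simp add: coord_sets_def)
    show "gradient f z \<bullet> w \<ge> 0"
    proof (rule limit_variational_inequality)
      show "continuous_on UNIV (gradient f)"
        by (rule continuous_gradient[OF Lip q])
      show "L J > 0"
        by (rule coord_Lipschitz_pos[OF Lip Jq])
      show "(X \<circ> r) k \<in> feasible_set a b e g" for k
        using X by simp
      show "(\<lambda>k. direction f L a e g J ((X \<circ> r) k)) \<longlonglongrightarrow> 0"
        using LIMSEQ_subseq_LIMSEQ[OF d0[OF Jq] r(1)] by (simp add: o_def)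
      show "w $ k = 0" if "k \<notin> J" for k
        using that J(1) by (intro w(1)) auto
    qed (fact r(2) w(2-4))+
  qed
qed

theorem theorem4p10:
  fixes f :: "real ^ 'n::finite \<Rightarrow> real"
    and q :: nat
    and a e g x0 :: "real ^ 'n"
    and b :: real
    and L :: "'n set \<Rightarrow> real"
    and M :: "'w measure"
    and J :: "nat \<Rightarrow> 'w \<Rightarrow> 'n set"
  assumes "2 \<le> q" and "q < CARD('n)"
    and "\<forall>i. e $ i \<le> g $ i"
    and "\<forall>x. f differentiable (at x)"
    and "coord_Lipschitz_gradient q L f"
    and "x0 \<in> feasible_set a b e g"
    and "prob_space M"
    and "uniform_draws M q J"
  shows "AE w in M. \<forall>z. accumulation_point (rccd f L a e g x0 (\<lambda>m. J m w)) z \<longrightarrow>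
           stationary_point f a b e g z"
proof -
  interpret prob_space M by fact
  have q: "q \<le> CARD('n)" using assms(2) by simp
  note diff = assms(4)[rule_format] and Lip = assms(5)
  note pos = coord_Lipschitz_pos[OF Lip]
  have indep: "indep_vars (\<lambda>_. count_space UNIV) J UNIV"
    using assms(8) unfolding uniform_draws_def by simp
  have in_q: "AE w in M. \<forall>m. J m w \<in> coord_sets q"
    by (rule AE_draws_coord_sets[OF assms(7,8) q])
  obtain C where C: "\<And>s n. (\<And>m. s m \<in> coord_sets q) \<Longrightarrow>
    (\<Sum>m<n. L (s m) / 2 * (norm (direction f L a e g (s m) (rccd f L a e g x0 s m)))\<^sup>2) \<le> C"
    using sum_steps_bounded[OF diff Lip assms(6)] by blast
  define N where "N S s m = (norm (direction f L a e g S (rccd f L a e g x0 s m)))\<^sup>2"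
    for S :: "'n set" and s :: "nat \<Rightarrow> 'n set" and m
  have N_nonneg: "N S s m \<ge> 0" for S s m
    by (simp add: N_def)
  (* at the times when S is drawn, N S equals the squared length of the step actually taken *)
  have N_lim: "AE w in M. N S (\<lambda>m. J m w) \<longlonglongrightarrow> 0" if S: "S \<in> coord_sets q" for S
  proof -
    let ?p = "ennreal (1 / card (coord_sets q :: 'n set set))"
    have "AE w in M. (\<Sum>m. ennreal (N S (\<lambda>k. J k w) m)) \<noteq> \<infinity>"
    proof (rule AE_suminf_history_finite[OF indep, where h = "\<lambda>m s. ennreal (N S s m)"])
      show "emeasure M {w \<in> space M. J m w = S} = ?p" for m
        by (rule emeasure_draw_eq[OF assms(7,8) q S])
      show "?p > 0"
        using S by (auto simp: card_gt_0_iff)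
      show "ennreal (N S s m) = ennreal (N S s' m)" if "\<And>k. k < m \<Longrightarrow> s k = s' k" for m s s'
        unfolding N_def using rccd_cong[OF that] by simp
      show "AE w in M. (\<Sum>m. indicator {S} (J m w) * ennreal (N S (\<lambda>k. J k w) m)) \<le> ennreal (2 * C / L S)"
        using in_q
      proof eventually_elim
        case (elim w)
        let ?s = "\<lambda>k. J k w"
        have "(\<Sum>m<n. indicator {S} (J m w) * ennreal (N S ?s m)) \<le> ennreal (2 * C / L S)" for n
        proof -
          have "(\<Sum>m<n. indicator {S} (J m w) * N S ?s m)
              \<le> (\<Sum>m<n. 2 / L S * (L (J m w) / 2 * N (J m w) ?s m))"
            using pos elim N_nonneg pos[OF S]
            by (intro sum_mono) (auto simp: indicator_def less_imp_le)
          also have "\<dots> \<le> 2 / L S * C"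
            unfolding sum_distrib_left[symmetric] N_def
            using C[of ?s n] elim pos[OF S] by (intro mult_left_mono) auto
          finally have "ennreal (\<Sum>m<n. indicator {S} (J m w) * N S ?s m) \<le> ennreal (2 * C / L S)"
            by (intro ennreal_leI) simp
          moreover have "(\<Sum>m<n. indicator {S} (J m w) * ennreal (N S ?s m))
              = (\<Sum>m<n. ennreal (indicator {S} (J m w) * N S ?s m))"
            by (intro sum.cong) (auto simp: indicator_def)
          ultimately show ?thesis
            using N_nonneg by (simp add: sum_ennreal)
        qed
        then show ?case
          by (intro suminf_le_const) auto
      qed
    qed simp
    then show ?thesis
    proof eventually_elim
      case (elim w)
      then have "summable (N S (\<lambda>k. J k w))"
        by (intro summable_suminf_not_top) (auto simp: N_nonneg)
      then show ?case by (rule summable_LIMSEQ_zero)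
    qed
  qed
  have "AE w in M. \<forall>S\<in>coord_sets q. N S (\<lambda>m. J m w) \<longlonglongrightarrow> 0"
    using N_lim by (intro AE_finite_allI) auto
  with in_q show ?thesis
  proof eventually_elim
    case (elim w)
    let ?s = "\<lambda>k. J k w"
    have "rccd f L a e g x0 ?s m \<in> feasible_set a b e g" for m
      using elim(1) by (intro rccd_feasible[OF assms(6)] pos) simp
    moreover have "(\<lambda>m. direction f L a e g S (rccd f L a e g x0 ?s m)) \<longlonglongrightarrow> 0"
      if "S \<in> coord_sets q" for S
    proof (rule tendsto_norm_zero_cancel)
      have "(\<lambda>m. sqrt (N S ?s m)) \<longlonglongrightarrow> sqrt 0"
        using elim(2) that by (intro tendsto_real_sqrt) auto
      then show "(\<lambda>m. norm (direction f L a e g S (rccd f L a e g x0 ?s m))) \<longlonglongrightarrow> 0"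
        by (simp add: N_def)
    qed
    ultimately show ?case
      using accumulation_point_stationary[OF assms(1) q Lip] by blast
  qed
qed

end
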